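(* For all $p,q\in\mathbb{R}$, the Gini mean $\mathscr{G}_{p,q}$ (on $\mathbb{R}_+$) is a weak-Hardy mean if and only if it is a Hardy mean.
   Context: $\mathbb{R}_+=(0,+\infty)$. For $p,q\in\mathbb{R}$ the Gini mean $\mathscr{G}_{p,q}\colon\bigcup_{n=1}^\infty\mathbb{R}_+^n\to\mathbb{R}_+$ is defined by $$\mathscr{G}_{p,q}(a_1,\ldots,a_n)=\begin{cases}\left(\dfrac{\sum_{i=1}^n a_i^p}{\sum_{i=1}^n a_i^q}\right)^{1/(p-q)} & \text{if } p\ne q,\\[3mm] \exp\left(\dfrac{\sum_{i=1}^{n} a_i^p\ln a_i}{\sum_{i=1}^{n}a_i^p}\right) & \text{if } p=q.\end{cases}$$ For an interval $I\subset[0,+\infty)$, $\ell_1(I)$ denotes the set of summable sequences with all terms in $I$. A mean $\mathscr{M}\colon\bigcup_{n=1}^\infty I^n\to I$ on $I$ is a Hardy mean if there is a finite constant $C$ such that $\sum_{n=1}^\infty \mathscr{M}(a_1,\dots,a_n)\le C\sum_{n=1}^\infty a_n$ for all $a\in\ell_1(I)$; it is a weak-Hardy mean if $\sum_{n=1}^\infty \mathscr{M}(a_1,\dots,a_n)<+\infty$ for all $a\in\ell_1(I)$. *)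

theory Defs
  imports "HOL-Analysis.Analysis"
begin

(* A point of the union of the I^n, n >= 1, is a nonempty list over I, so a mean on I is a function
   on lists; its values on other lists are irrelevant. *)

definition gini_mean :: "real \<Rightarrow> real \<Rightarrow> real list \<Rightarrow> real" where
  "gini_mean p q as =
     (if p \<noteq> q
      then ((\<Sum>x\<leftarrow>as. x powr p) / (\<Sum>x\<leftarrow>as. x powr q)) powr (1 / (p - q))
      else exp ((\<Sum>x\<leftarrow>as. x powr p * ln x) / (\<Sum>x\<leftarrow>as. x powr p)))"

lemma gini_mean_pos:
  assumes "as \<noteq> []" "set as \<subseteq> {0<..}"
  shows "gini_mean p q as > 0"
proof -
  have "(\<Sum>x\<leftarrow>as. x powr r) > 0" for r
    using assms
  proof (induction as rule: list_nonempty_induct)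
    case (single x)
    then show ?case by simp
  next
    case (cons x xs)
    then show ?case by (simp add: add_pos_pos)
  qed
  then show ?thesis
    by (simp add: gini_mean_def less_imp_neq [symmetric])
qed

definition ell1 :: "real set \<Rightarrow> (nat \<Rightarrow> real) set" where
  "ell1 I = {a. range a \<subseteq> I \<and> summable a}"

(* Intended for an interval I contained in {0..} and M mapping nonempty lists over I into I.
   Sequences are indexed from 0: the n-th summand is the mean of a 0, ..., a n.
   Finiteness of the series of means is expressed by summability, because suminf of a divergent
   series is an unspecified real number. *)

definition hardy_mean :: "real set \<Rightarrow> (real list \<Rightarrow> real) \<Rightarrow> bool" where
  "hardy_mean I M \<longleftrightarrow>
     (\<exists>C::real. \<forall>a\<in>ell1 I. summable (\<lambda>n. M (map a [0..<Suc n])) \<and>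
        (\<Sum>n. M (map a [0..<Suc n])) \<le> C * (\<Sum>n. a n))"

definition weak_hardy_mean :: "real set \<Rightarrow> (real list \<Rightarrow> real) \<Rightarrow> bool" where
  "weak_hardy_mean I M \<longleftrightarrow>
     (\<forall>a\<in>ell1 I. summable (\<lambda>n. M (map a [0..<Suc n])))"

end

theory Submission
  imports Defs
begin

text \<open>By symmetry let \<open>q \<le> p\<close>. If \<open>q \<le> 0\<close> and \<open>p < 1\<close>, log-convexity of the power sums in the exponent
  bounds the Gini mean by a power mean of exponent in \<open>(0, 1)\<close>, which satisfies Hardy's inequality.
  Otherwise the mean is not even weak-Hardy. If \<open>q > 0\<close>, the means of a geometric sequence stay away
  from \<open>0\<close>. If \<open>q \<le> 0\<close> and \<open>p \<ge> 1\<close>, the means of \<open>1 / (n (1 + ln n)\<^sup>e)\<close> are at least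
  \<open>1 / (n (1 + ln n))\<close> for a suitable \<open>e > 1\<close>.\<close>

section \<open>Power sums and monotonicity of Gini means\<close>

definition power_sum :: "real \<Rightarrow> real list \<Rightarrow> real" where
  "power_sum r as = (\<Sum>x\<leftarrow>as. x powr r)"

lemma gini_mean_neq:
  "p \<noteq> q \<Longrightarrow> gini_mean p q as = (power_sum p as / power_sum q as) powr (1 / (p - q))"
  by (simp add: gini_mean_def power_sum_def)

lemma gini_mean_eq:
  "gini_mean p p as = exp ((\<Sum>x\<leftarrow>as. x powr p * ln x) / power_sum p as)"
  by (simp add: gini_mean_def power_sum_def)

lemma power_sum_map_upt: "power_sum r (map a [0..<n]) = (\<Sum>k<n. a k powr r)"
  unfolding power_sum_def by (simp add: interv_sum_list_conv_sum_set_nat atLeast0LessThan comp_def)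

lemma power_sum_pos:
  assumes "as \<noteq> []" "set as \<subseteq> {0<..}"
  shows "power_sum r as > 0"
  using assms
proof (induction as rule: list_nonempty_induct)
  case (single x)
  then show ?case by (simp add: power_sum_def)
next
  case (cons x xs)
  then show ?case by (simp add: power_sum_def add_pos_pos)
qed

lemma gini_mean_commute:
  assumes "as \<noteq> []" "set as \<subseteq> {0<..}"
  shows "gini_mean p q as = gini_mean q p as"
proof (cases "p = q")
  case False
  have "power_sum p as > 0" "power_sum q as > 0"
    using assms by (auto intro: power_sum_pos)
  then have "power_sum p as / power_sum q as = (power_sum q as / power_sum p as) powr (- 1)"
    by (simp add: powr_minus)
  then have "(power_sum p as / power_sum q as) powr (1 / (p - q))
      = (power_sum q as / power_sum p as) powr (- 1 * (1 / (p - q)))"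
    by (simp only: powr_powr)
  also have "- 1 * (1 / (p - q)) = 1 / (q - p)"
    using False by (simp add: field_simps)
  finally show ?thesis
    using False by (simp add: gini_mean_neq)
qed simp

text \<open>Comparing Gini means becomes comparing slopes of chords of
  \<open>\<lambda>r. ln (power_sum r as)\<close>.\<close>

lemma gini_mean_exp_slope:
  assumes "as \<noteq> []" "set as \<subseteq> {0<..}" "p \<noteq> q"
  shows "gini_mean p q as = exp ((ln (power_sum p as) - ln (power_sum q as)) / (p - q))"
proof -
  have "power_sum p as > 0" "power_sum q as > 0"
    using assms by (auto intro: power_sum_pos)
  then show ?thesis
    using assms by (simp add: gini_mean_neq powr_def ln_div)
qed

text \<open>\<open>ln (gini_mean p p as)\<close> is the derivative of
  \<open>ln (power_sum r as)\<close> at \<open>r = p\<close>, so this is a supporting line. It comes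
  from summing \<open>1 + y \<le> exp y\<close> over the entries.\<close>

lemma ln_power_sum_tangent:
  assumes "as \<noteq> []" "set as \<subseteq> {0<..}"
  shows "ln (power_sum p as) + ln (gini_mean p p as) * (r - p) \<le> ln (power_sum r as)"
proof -
  define m where "m = (\<Sum>x\<leftarrow>as. x powr p * ln x) / power_sum p as"
  have pos: "power_sum p as > 0" "power_sum r as > 0"
    using assms by (auto intro: power_sum_pos)
  \<comment> \<open>Here \<open>y = (r - p) * (ln x - m)\<close>, and both sides are scaled by
    \<open>exp ((r - p) * m) * x powr p\<close>.\<close>
  have pt: "exp ((r - p) * m) * (x powr p + (r - p) * (x powr p * ln x) - (r - p) * m * x powr p) \<le> x powr r"
    if "x > 0" for x
  proof -
    have "1 + (r - p) * (ln x - m) \<le> exp ((r - p) * (ln x - m))"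
      by (rule exp_ge_add_one_self)
    then have "exp ((r - p) * m) * x powr p * (1 + (r - p) * (ln x - m))
        \<le> exp ((r - p) * m) * x powr p * exp ((r - p) * (ln x - m))"
      by (intro mult_left_mono) auto
    also have "\<dots> = x powr r"
      using that by (simp add: powr_def algebra_simps flip: exp_add)
    finally show ?thesis by (simp add: algebra_simps)
  qed
  \<comment> \<open>As \<open>m\<close> is the mean of \<open>ln x\<close> with weights
    \<open>x powr p\<close>, the first-order terms cancel in the sum.\<close>
  have "power_sum p as * exp ((r - p) * m)
      = exp ((r - p) * m) * (power_sum p as + (r - p) * (\<Sum>x\<leftarrow>as. x powr p * ln x)
          - (r - p) * m * power_sum p as)"
    using pos by (simp add: m_def)
  also have "\<dots> = (\<Sum>x\<leftarrow>as. exp ((r - p) * m) *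
      (x powr p + (r - p) * (x powr p * ln x) - (r - p) * m * x powr p))"
    unfolding power_sum_def
    by (simp add: sum_list_const_mult sum_list_addf sum_list_subtractf)
  also have "\<dots> \<le> power_sum r as"
    unfolding power_sum_def using assms(2) by (intro sum_list_mono pt) auto
  finally have "ln (power_sum p as * exp ((r - p) * m)) \<le> ln (power_sum r as)"
    using pos by simp
  then show ?thesis
    using pos by (simp add: gini_mean_eq m_def ln_mult mult.commute)
qed

text \<open>A function with a supporting line at every point is convex: average the line at
  \<open>z\<close> over the two endpoints.\<close>

lemma convex_ln_power_sum:
  assumes "as \<noteq> []" "set as \<subseteq> {0<..}"
  shows "convex_on UNIV (\<lambda>r. ln (power_sum r as))"
proof (rule convex_onI)
  fix t x y :: real
  assume t: "0 < t" "t < 1"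
  define z where "z = (1 - t) * x + t * y"
  define L where "L = (\<lambda>r. ln (power_sum r as))"
  define m where "m = ln (gini_mean z z as)"
  have L: "L z + m * (r - z) \<le> L r" for r
    unfolding L_def m_def using assms by (rule ln_power_sum_tangent)
  have "L z = (1 - t) * (L z + m * (x - z)) + t * (L z + m * (y - z))"
    by (simp add: z_def algebra_simps)
  also have "\<dots> \<le> (1 - t) * L x + t * L y"
    using t by (intro add_mono mult_left_mono L) auto
  finally show "ln (power_sum ((1 - t) *\<^sub>R x + t *\<^sub>R y) as)
      \<le> (1 - t) * ln (power_sum x as) + t * ln (power_sum y as)"
    by (simp add: L_def z_def)
qed auto

text \<open>The slope of the tangent at \<open>p\<close> is at most that of any chord from
  \<open>p\<close> to the right. The next lemma is the mirror image on the left.\<close>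

lemma gini_mean_diag_le:
  assumes "as \<noteq> []" "set as \<subseteq> {0<..}" "p < r"
  shows "gini_mean p p as \<le> gini_mean r p as"
proof -
  have "ln (gini_mean p p as) \<le> (ln (power_sum r as) - ln (power_sum p as)) / (r - p)"
    using ln_power_sum_tangent[OF assms(1,2), of p r] assms(3) by (simp add: field_simps)
  then have "exp (ln (gini_mean p p as)) \<le> exp ((ln (power_sum r as) - ln (power_sum p as)) / (r - p))"
    by simp
  then show ?thesis
    using assms gini_mean_pos[OF assms(1,2), of p p] by (simp add: gini_mean_exp_slope)
qed

lemma gini_mean_le_diag:
  assumes "as \<noteq> []" "set as \<subseteq> {0<..}" "r < p"
  shows "gini_mean p r as \<le> gini_mean p p as"
proof -
  have "(ln (power_sum p as) - ln (power_sum r as)) / (p - r) \<le> ln (gini_mean p p as)"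
    using ln_power_sum_tangent[OF assms(1,2), of p r] assms(3) by (simp add: field_simps)
  then have "exp ((ln (power_sum p as) - ln (power_sum r as)) / (p - r)) \<le> exp (ln (gini_mean p p as))"
    by simp
  then show ?thesis
    using assms gini_mean_pos[OF assms(1,2), of p p] by (simp add: gini_mean_exp_slope)
qed

lemma gini_mean_mono_left:
  assumes "as \<noteq> []" "set as \<subseteq> {0<..}" "q < p" "p \<le> s"
  shows "gini_mean p q as \<le> gini_mean s q as"
proof (cases "p = s")
  case False
  have "(ln (power_sum q as) - ln (power_sum p as)) / (q - p)
      \<le> (ln (power_sum q as) - ln (power_sum s as)) / (q - s)"
    using assms False by (intro convex_on_slope_le(1)[OF convex_ln_power_sum]) auto
  then have "(ln (power_sum p as) - ln (power_sum q as)) / (p - q)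
      \<le> (ln (power_sum s as) - ln (power_sum q as)) / (s - q)"
    by (metis minus_diff_eq minus_divide_divide)
  then show ?thesis
    using assms by (simp add: gini_mean_exp_slope)
qed simp

lemma gini_mean_mono_right:
  assumes "as \<noteq> []" "set as \<subseteq> {0<..}" "p \<le> q" "q < s"
  shows "gini_mean s p as \<le> gini_mean s q as"
proof (cases "p = q")
  case False
  have "(ln (power_sum p as) - ln (power_sum s as)) / (p - s)
      \<le> (ln (power_sum q as) - ln (power_sum s as)) / (q - s)"
    using assms False by (intro convex_on_slope_le(2)[OF convex_ln_power_sum]) auto
  then have "(ln (power_sum s as) - ln (power_sum p as)) / (s - p)
      \<le> (ln (power_sum s as) - ln (power_sum q as)) / (s - q)"
    by (metis minus_diff_eq minus_divide_divide)
  then show ?thesis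
    using assms by (simp add: gini_mean_exp_slope)
qed simp

text \<open>Raise \<open>p\<close> to \<open>s\<close> first, then \<open>q\<close> to
  \<open>0\<close>; on positive entries \<open>power_sum 0\<close> counts them, so the bound is the
  power mean of exponent \<open>s\<close>.\<close>

lemma gini_mean_le_power_mean:
  assumes "as \<noteq> []" "set as \<subseteq> {0<..}" "q \<le> 0" "q \<le> p" "p \<le> s" "0 < s"
  shows "gini_mean p q as \<le> gini_mean s 0 as"
proof -
  have "gini_mean p q as \<le> gini_mean s q as"
    using assms gini_mean_diag_le[of as p s] gini_mean_mono_left[of as q p s]
    by (cases "p = q") auto
  also have "\<dots> \<le> gini_mean s 0 as"
    using assms by (intro gini_mean_mono_right) auto
  finally show ?thesis .
qed

subsection \<open>Hardy's inequality\<close>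

text \<open>The graph of \<open>y powr t\<close> lies above its tangent at \<open>y = x\<close>;
  equivalently, Young's inequality with exponents \<open>t\<close> and
  \<open>t / (t - 1)\<close>.\<close>

lemma powr_tangent_le:
  fixes x y t :: real
  assumes "1 < t" "0 \<le> x" "0 \<le> y"
  shows "t * x powr (t - 1) * y \<le> (t - 1) * x powr t + y powr t"
proof -
  have "y * x powr (t - 1)
      \<le> y powr t / t + (x powr (t - 1)) powr (t / (t - 1)) / (t / (t - 1))"
    using assms by (intro Youngs_inequality) (auto simp: field_simps)
  also have "(x powr (t - 1)) powr (t / (t - 1)) = x powr t"
    using assms by (simp add: powr_powr)
  finally show ?thesis
    using assms by (simp add: field_simps)
qed

text \<open>Elliott's argument: by Young's inequality, the difference of the summands is dominated by the
  increments of the last term.\<close>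
lemma Hardy_Elliott:
  fixes b :: "nat \<Rightarrow> real"
  assumes t: "1 < t" and b: "\<And>n. 0 \<le> b n"
  defines "A \<equiv> \<lambda>n. (\<Sum>k<n. b k) / real n"
  shows "(t - 1) * (\<Sum>n<N. A (Suc n) powr t)
      \<le> t * (\<Sum>n<N. A (Suc n) powr (t - 1) * b n) - real N * A N powr t"
proof (induction N)
  case (Suc N)
  define x where "x = A (Suc N)"
  define y where "y = A N"
  have xy: "0 \<le> x" "0 \<le> y"
    using b by (auto simp: x_def y_def A_def intro!: divide_nonneg_nonneg sum_nonneg simp del: sum.lessThan_Suc)
  \<comment> \<open>\<open>b N\<close> is recovered from consecutive averages. For
    \<open>N = 0\<close> both sides of the first equation vanish, whatever \<open>A 0\<close>
    is.\<close>
  have "real N * y = (\<Sum>k<N. b k)" "(real N + 1) * x = (\<Sum>k<Suc N. b k)"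
    by (auto simp: x_def y_def A_def field_simps)
  then have bN: "b N = (real N + 1) * x - real N * y"
    by simp
  have xt: "x powr (t - 1) * x = x powr t"
    using t xy(1) by (cases "x = 0") (auto simp: powr_diff)
  have "real N * (t * x powr (t - 1) * y) \<le> real N * ((t - 1) * x powr t + y powr t)"
    using t xy by (intro mult_left_mono powr_tangent_le) auto
  moreover have "t * (x powr (t - 1) * b N)
      = t * (real N + 1) * (x powr (t - 1) * x) - real N * (t * x powr (t - 1) * y)"
    by (simp add: bN algebra_simps)
  \<comment> \<open>The last two terms telescope with the subtracted term of the induction
    hypothesis.\<close>
  ultimately have "(t - 1) * x powr t \<le> t * (x powr (t - 1) * b N) + real N * y powr t - (real N + 1) * x powr t"
    unfolding xt by (simp add: algebra_simps)
  with Suc.IH show ?case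
    by (simp add: algebra_simps flip: x_def y_def)
qed simp

text \<open>Elliott's mixed products are split with a small weight on the averages, whose sum is
  then absorbed on the left. The constant is \<open>(2 * t / (t - 1)) powr t\<close>.\<close>

lemma Hardy_inequality:
  fixes t :: real
  assumes t: "1 < t"
  obtains C where "\<And>b N. (\<And>n. 0 \<le> b n) \<Longrightarrow>
    (\<Sum>n<N. ((\<Sum>k<Suc n. b k) / real (Suc n)) powr t) \<le> C * (\<Sum>n<N. b n powr t)"
proof
  \<comment> \<open>Chosen so that \<open>t * \<delta>\<close> is half of the coefficient
    \<open>t - 1\<close> on the left.\<close>
  define \<delta> where "\<delta> = (t - 1) / (2 * t)"
  define D where "D = (1 / \<delta>) powr (t - 1)"
  have \<delta>: "0 < \<delta>" using t by (simp add: \<delta>_def)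
  \<comment> \<open>Either \<open>y\<close> is replaced by \<open>\<delta> * x\<close>, or
    \<open>x\<close> by \<open>y / \<delta>\<close>, which produces \<open>D\<close>.\<close>
  have step: "x powr (t - 1) * y \<le> \<delta> * x powr t + D * y powr t" if "0 \<le> x" "0 \<le> y" for x y
  proof (cases "y \<le> \<delta> * x")
    case True
    have "x powr (t - 1) * y \<le> x powr (t - 1) * (\<delta> * x)"
      using True by (intro mult_left_mono) auto
    also have "\<dots> = \<delta> * x powr t"
      using t that by (cases "x = 0") (auto simp: powr_diff)
    finally show ?thesis
      by (simp add: D_def add_increasing2)
  next
    case False
    with \<delta> that have "0 < y" "x \<le> 1 / \<delta> * y"
      by (auto simp: field_simps intro: le_less_trans[of 0 "\<delta> * x"])
    then have "x powr (t - 1) * y \<le> (1 / \<delta> * y) powr (t - 1) * y"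
      using t that by (intro mult_right_mono powr_mono2) auto
    also have "\<dots> = D * y powr t"
      using \<open>0 < y\<close> \<delta> by (simp add: D_def powr_mult powr_diff powr_divide)
    finally show ?thesis
      using \<delta> by (simp add: add_increasing)
  qed
  fix b :: "nat \<Rightarrow> real" and N :: nat
  assume b: "\<And>n. 0 \<le> b n"
  define A where "A = (\<lambda>n. (\<Sum>k<n. b k) / real n)"
  define S where "S = (\<Sum>n<N. A (Suc n) powr t)"
  have A: "0 \<le> A n" for n
    using b by (auto simp: A_def intro!: divide_nonneg_nonneg sum_nonneg)
  have "(t - 1) * S \<le> t * (\<Sum>n<N. A (Suc n) powr (t - 1) * b n) - real N * A N powr t"
    unfolding S_def A_def using t b by (rule Hardy_Elliott)
  also have "\<dots> \<le> t * (\<Sum>n<N. A (Suc n) powr (t - 1) * b n)"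
    by simp
  also have "\<dots> \<le> t * (\<Sum>n<N. \<delta> * A (Suc n) powr t + D * b n powr t)"
    using t by (intro mult_left_mono sum_mono step A b) auto
  also have "\<dots> = t * \<delta> * S + t * D * (\<Sum>n<N. b n powr t)"
    by (simp add: sum.distrib S_def sum_distrib_left distrib_left mult.assoc)
  also have "t * \<delta> = (t - 1) / 2"
    using t by (simp add: \<delta>_def)
  finally have "S \<le> 2 * t * D / (t - 1) * (\<Sum>n<N. b n powr t)"
    using t by (simp add: field_simps)
  then show "(\<Sum>n<N. ((\<Sum>k<Suc n. b k) / real (Suc n)) powr t)
      \<le> 2 * t * D / (t - 1) * (\<Sum>n<N. b n powr t)"
    by (simp only: S_def A_def)
qed

section \<open>Application to Gini means\<close>

lemma hardy_gini_mean:
  assumes "q \<le> 0" "q \<le> p" "p < 1"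
  shows "hardy_mean {0<..} (gini_mean p q)"
proof -
  \<comment> \<open>The \<open>1/2\<close> keeps \<open>s\<close> positive when
    \<open>p \<le> 0\<close>. Hardy's inequality is applied with exponent \<open>1/s\<close> to the
    sequence \<open>a n powr s\<close>.\<close>
  define s where "s = max p (1/2)"
  have s: "0 < s" "s < 1" "p \<le> s"
    using assms by (auto simp: s_def)
  obtain C where C: "\<And>b N. (\<And>n. 0 \<le> b n) \<Longrightarrow>
      (\<Sum>n<N. ((\<Sum>k<Suc n. b k) / real (Suc n)) powr (1/s)) \<le> C * (\<Sum>n<N. b n powr (1/s))"
    using Hardy_inequality[of "1/s"] s by auto
  have C_nonneg: "0 \<le> C"
    using C[of "\<lambda>_. 1" 1] by simp
  show ?thesis
    unfolding hardy_mean_def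
  proof (intro exI ballI)
    fix a
    assume "a \<in> ell1 {0<..}"
    then have a: "\<And>n. 0 < a n" "summable a"
      by (auto simp: ell1_def)
    have set: "set (map a [0..<Suc n]) \<subseteq> {0<..}" for n
      using a by auto
    define g where "g = (\<lambda>n. gini_mean p q (map a [0..<Suc n]))"
    have g: "0 \<le> g n" for n
      unfolding g_def by (intro less_imp_le gini_mean_pos set) auto
    have g_le: "g n \<le> ((\<Sum>k<Suc n. a k powr s) / real (Suc n)) powr (1/s)" for n
    proof -
      have "g n \<le> gini_mean s 0 (map a [0..<Suc n])"
        unfolding g_def using assms s by (intro gini_mean_le_power_mean set) auto
      also have "\<dots> = ((\<Sum>k<Suc n. a k powr s) / (\<Sum>k<Suc n. a k powr 0)) powr (1/s)"
        using s by (simp only: gini_mean_neq power_sum_map_upt) simp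
      \<comment> \<open>Positivity of the terms matters, as \<open>0 powr 0 = 0\<close>.\<close>
      also have "(\<Sum>k<Suc n. a k powr 0) = real (Suc n)"
        using a(1) by (simp add: less_imp_neq[symmetric] del: sum.lessThan_Suc)
      finally show ?thesis .
    qed
    have bound: "sum g {..<N} \<le> C * suminf a" for N
    proof -
      have "sum g {..<N} \<le> (\<Sum>n<N. ((\<Sum>k<Suc n. a k powr s) / real (Suc n)) powr (1/s))"
        by (intro sum_mono g_le)
      also have "\<dots> \<le> C * (\<Sum>n<N. (a n powr s) powr (1/s))"
        by (intro C) simp
      also have "(\<Sum>n<N. (a n powr s) powr (1/s)) = sum a {..<N}"
        using s a(1) by (simp add: powr_powr less_imp_le)
      also have "C * sum a {..<N} \<le> C * suminf a"
        using a C_nonneg by (intro mult_left_mono sum_le_suminf) (auto intro: less_imp_le)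
      finally show ?thesis .
    qed
    have "summable g"
      using g bound by (rule summableI_nonneg_bounded)
    with bound show "summable (\<lambda>n. gini_mean p q (map a [0..<Suc n])) \<and>
        (\<Sum>n. gini_mean p q (map a [0..<Suc n])) \<le> C * suminf a"
      unfolding g_def[symmetric] by (auto intro: suminf_le_const)
  qed
qed

subsection \<open>Summable sequences with divergent series of means\<close>

lemma not_weak_hardy_gini_mean_pos:
  assumes "0 < q" "q \<le> p"
  shows "\<not> weak_hardy_mean {0<..} (gini_mean p q)"
proof
  assume weak: "weak_hardy_mean {0<..} (gini_mean p q)"
  define a :: "nat \<Rightarrow> real" where "a = (\<lambda>n. (1/2) ^ n)"
  have "a \<in> ell1 {0<..}"
    by (auto simp: ell1_def a_def)
  with weak have "summable (\<lambda>n. gini_mean p q (map a [0..<Suc n]))"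
    by (auto simp: weak_hardy_mean_def)
  then have lim: "(\<lambda>n. gini_mean p q (map a [0..<Suc n])) \<longlonglongrightarrow> 0"
    by (rule summable_LIMSEQ_zero)
  have set: "set (map a [0..<Suc n]) \<subseteq> {0<..}" for n
    by (auto simp: a_def)
  \<comment> \<open>On the diagonal the mean is bounded below by the quotient formula with a smaller
    second exponent, still positive so that the \<open>r\<close>-th powers form a convergent
    geometric series.\<close>
  define r where "r = (if p = q then q / 2 else q)"
  have r: "0 < r" "r < p"
    using assms by (auto simp: r_def)
  define c where "c = (1/2::real) powr r"
  have c: "0 < c" "c < 1"
    using r using powr_less_mono'[of "1/2" 0 r] by (auto simp: c_def)
  have "(1 - c) powr (1 / (p - r)) \<le> gini_mean p q (map a [0..<Suc n])" for n
  proof -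
    have ac: "a k powr r = c ^ k" for k
      by (induction k) (auto simp: a_def c_def powr_mult powr_divide)
    have "(\<Sum>k<Suc n. a k powr r) = (1 - c ^ Suc n) / (1 - c)"
      using c by (subst ac) (simp only: sum_gp_strict, simp)
    also have "\<dots> \<le> 1 / (1 - c)"
      using c by (intro divide_right_mono) auto
    finally have le: "power_sum r (map a [0..<Suc n]) \<le> 1 / (1 - c)"
      by (simp only: power_sum_map_upt)
    \<comment> \<open>The first term \<open>a 0 = 1\<close> alone keeps the numerator away from
      \<open>0\<close>.\<close>
    have "a 0 powr p \<le> (\<Sum>k<Suc n. a k powr p)"
      by (rule member_le_sum) auto
    then have ge: "1 \<le> power_sum p (map a [0..<Suc n])"
      unfolding power_sum_map_upt by (simp add: a_def del: sum.lessThan_Suc)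
    have "1 - c = 1 / (1 / (1 - c))"
      by simp
    also have "\<dots> \<le> power_sum p (map a [0..<Suc n]) / power_sum r (map a [0..<Suc n])"
      using le ge power_sum_pos[OF _ set, of n r] by (intro frac_le) auto
    finally have "(1 - c) powr (1 / (p - r)) \<le> gini_mean p r (map a [0..<Suc n])"
      using c r unfolding gini_mean_neq[OF less_imp_neq[OF r(2), symmetric]]
      by (intro powr_mono2) auto
    also have "\<dots> \<le> gini_mean p q (map a [0..<Suc n])"
      using gini_mean_le_diag[OF _ set r(2)] by (auto simp: r_def)
    finally show ?thesis .
  qed
  with lim have "(1 - c) powr (1 / (p - r)) \<le> 0"
    by (intro LIMSEQ_le_const) auto
  with c show False by simp
qed

text \<open>Cauchy condensation reduces this to the series of
  \<open>(1 + real n * ln 2) powr - e\<close>, comparable with that of \<open>n powr - e\<close>.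
  Adding \<open>1\<close> to the logarithm keeps that factor at least \<open>1\<close>.\<close>

lemma summable_inverse_mult_ln_powr:
  assumes "1 < e"
  shows "summable (\<lambda>n. 1 / (real (Suc n) * (1 + ln (real (Suc n))) powr e))"
proof -
  define f where "f = (\<lambda>n. if n = 0 then 0 else 1 / (real n * (1 + ln (real n)) powr e))"
  have ln_pos: "1 + ln (real m) \<noteq> 0" if "0 < m" for m
    using ln_ge_zero[of "real m"] that by linarith
  have "f (Suc m) \<le> f m" if "0 < m" for m
    using that assms ln_pos[of m] ln_pos[of "Suc m"] unfolding f_def
    by (auto intro!: divide_left_mono mult_mono powr_mono2 mult_pos_pos
        add_nonneg_nonneg add_pos_nonneg simp del: of_nat_Suc)
  moreover have "0 \<le> f m" for m
    by (simp add: f_def)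
  ultimately have "summable f \<longleftrightarrow> summable (\<lambda>n. 2 ^ n * f (2 ^ n))"
    by (rule condensation_test)
  also have "(\<lambda>n. 2 ^ n * f (2 ^ n)) = (\<lambda>n. (1 + real n * ln 2) powr - e)"
    by (auto simp: f_def ln_realpow powr_minus field_simps)
  also have "summable \<dots>"
  proof (rule summable_comparison_test')
    show "summable (\<lambda>n. ln 2 powr - e * real (Suc n) powr - e)"
      using assms by (subst summable_Suc_iff[of "\<lambda>n. ln 2 powr - e * real n powr - e"])
        (auto intro!: summable_mult simp: summable_real_powr_iff)
    fix n :: nat
    have "ln 2 * real (Suc n) \<le> 1 + real n * ln 2"
      using ln_2_less_1 by (simp add: algebra_simps)
    then have "(1 + real n * ln 2) powr - e \<le> (ln 2 * real (Suc n)) powr - e"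
      using assms by (intro powr_mono2') auto
    then show "norm ((1 + real n * ln 2) powr - e) \<le> ln 2 powr - e * real (Suc n) powr - e"
      by (simp add: powr_mult)
  qed
  finally have "summable (\<lambda>n. f (Suc n))"
    by (simp add: summable_Suc_iff)
  then show ?thesis
    by (simp add: f_def)
qed

text \<open>The same condensation at the critical exponent leads to the harmonic series.\<close>

lemma not_summable_inverse_mult_ln:
  "\<not> summable (\<lambda>n. 1 / (real (Suc n) * (1 + ln (real (Suc n)))))"
proof
  assume *: "summable (\<lambda>n. 1 / (real (Suc n) * (1 + ln (real (Suc n)))))"
  define f where "f = (\<lambda>n. if n = 0 then 0 else 1 / (real n * (1 + ln (real n))))"
  have "f (Suc m) \<le> f m" if "0 < m" for m
    using that unfolding f_def
    by (auto intro!: divide_left_mono mult_mono mult_pos_pos add_nonneg_nonneg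
        add_pos_nonneg simp del: of_nat_Suc)
  moreover have "0 \<le> f m" for m
    by (cases m) (auto simp: f_def)
  ultimately have "summable f \<longleftrightarrow> summable (\<lambda>n. 2 ^ n * f (2 ^ n))"
    by (rule condensation_test)
  also have "(\<lambda>n. 2 ^ n * f (2 ^ n)) = (\<lambda>n. 1 / (1 + real n * ln 2))"
    by (auto simp: f_def ln_realpow)
  finally have "summable f \<longleftrightarrow> summable (\<lambda>n. 1 / (1 + real n * ln 2))" .
  moreover have "summable f"
    using * by (subst summable_Suc_iff[symmetric]) (simp add: f_def)
  ultimately have "summable (\<lambda>n. 1 / (1 + real n * ln 2))"
    by simp
  then have "summable (\<lambda>n. 1 / real (Suc n))"
  proof (rule summable_comparison_test'[where N = 0])
    fix n :: nat
    have "1 + real n * ln 2 \<le> real (Suc n)"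
      using ln_2_less_1 by (simp add: mult_left_le)
    then show "norm (1 / real (Suc n)) \<le> 1 / (1 + real n * ln 2)"
      by (auto intro!: divide_left_mono mult_pos_pos add_pos_nonneg)
  qed
  then have "summable (\<lambda>n. 1 / real n)"
    by (subst summable_Suc_iff[symmetric])
  then show False
    using not_summable_harmonic[where 'a = real] by (simp add: inverse_eq_divide)
qed

text \<open>The exponent \<open>e > 1\<close> is chosen with \<open>- q e \<le> 1 - q\<close>, so that the logarithms in the sum of \<open>q\<close>-th
  powers contribute at most the power \<open>1 - q\<close> of \<open>1 + ln n\<close>.\<close>
lemma not_weak_hardy_gini_mean_ge_1:
  assumes "q \<le> 0" "1 \<le> p"
  shows "\<not> weak_hardy_mean {0<..} (gini_mean p q)"
proof
  assume weak: "weak_hardy_mean {0<..} (gini_mean p q)"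
  define e where "e = 1 + 1 / (1 - q)"
  have e: "1 < e" "- q * e \<le> 1 - q"
    using assms by (auto simp: e_def field_simps)
  define L where "L = (\<lambda>n. 1 + ln (real (Suc n)))"
  define a where "a = (\<lambda>n. 1 / (real (Suc n) * L n powr e))"
  have L: "1 \<le> L n" for n
    by (simp add: L_def)
  have a_pos: "0 < a n" for n
    using L[of n] by (simp add: a_def)
  have "summable a"
    unfolding a_def L_def using e(1) by (rule summable_inverse_mult_ln_powr)
  with a_pos have "a \<in> ell1 {0<..}"
    by (auto simp: ell1_def)
  with weak have summ: "summable (\<lambda>n. gini_mean p q (map a [0..<Suc n]))"
    by (auto simp: weak_hardy_mean_def)
  have lower: "1 / (real (Suc n) * L n) \<le> gini_mean p q (map a [0..<Suc n])" for n
  proof -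
    define u where "u = real (Suc n) * L n"
    have "1 * 1 \<le> u"
      unfolding u_def by (intro mult_mono L) auto
    then have u: "1 \<le> u" by simp
    have "a k powr q \<le> real (Suc n) powr - q * L n powr (1 - q)" if "k < Suc n" for k
    proof -
      have kn: "L k \<le> L n" "real (Suc k) \<le> real (Suc n)"
        using that by (auto simp: L_def)
      have "a k powr q = (real (Suc k) * L k powr e) powr - q"
        using L[of k] by (simp add: a_def powr_minus powr_divide field_simps)
      also have "\<dots> = real (Suc k) powr - q * L k powr (- q * e)"
        using L[of k] by (simp add: powr_mult powr_powr mult.commute)
      \<comment> \<open>Both exponents are nonnegative, so the last index dominates.\<close>
      also have "\<dots> \<le> real (Suc n) powr - q * L n powr (- q * e)"
        using L[of k] assms e kn by (intro mult_mono powr_mono2) (auto intro: mult_nonpos_nonneg)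
      also have "\<dots> \<le> real (Suc n) powr - q * L n powr (1 - q)"
        using L e by (intro mult_left_mono powr_mono) auto
      finally show ?thesis .
    qed
    then have "(\<Sum>k<Suc n. a k powr q) \<le> of_nat (card {..<Suc n}) * (real (Suc n) powr - q * L n powr (1 - q))"
      by (intro sum_bounded_above) auto
    \<comment> \<open>The number \<open>Suc n\<close> of summands supplies the missing factor,
      giving both factors of \<open>u\<close> the exponent \<open>1 - q\<close>.\<close>
    also have "\<dots> = u powr (1 - q)"
      using L[of n] by (simp add: u_def powr_mult powr_diff powr_minus divide_inverse del: of_nat_Suc)
    \<comment> \<open>Here \<open>1 \<le> p\<close> enters. The exponent \<open>p - q\<close> is the
      one that the outer power \<open>1 / (p - q)\<close> turns into exactly
      \<open>1 / u\<close>.\<close>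
    also have "\<dots> \<le> u powr (p - q)"
      using u assms by (intro powr_mono) auto
    finally have le: "power_sum q (map a [0..<Suc n]) \<le> u powr (p - q)"
      by (simp only: power_sum_map_upt)
    have "a 0 powr p \<le> (\<Sum>k<Suc n. a k powr p)"
      by (rule member_le_sum) auto
    then have ge: "1 \<le> power_sum p (map a [0..<Suc n])"
      unfolding power_sum_map_upt by (simp add: a_def L_def del: sum.lessThan_Suc)
    have "0 < power_sum q (map a [0..<Suc n])"
      using a_pos by (intro power_sum_pos) auto
    then have "1 / u powr (p - q) \<le> power_sum p (map a [0..<Suc n]) / power_sum q (map a [0..<Suc n])"
      using le ge by (intro frac_le) auto
    then have "(1 / u powr (p - q)) powr (1 / (p - q)) \<le> gini_mean p q (map a [0..<Suc n])"
      using assms by (subst gini_mean_neq) (auto intro: powr_mono2)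
    also have "(1 / u powr (p - q)) powr (1 / (p - q)) = 1 / u"
      using u assms by (simp add: powr_divide powr_powr)
    finally show ?thesis
      by (simp add: u_def)
  qed
  have "summable (\<lambda>n. 1 / (real (Suc n) * L n))"
  proof (rule summable_comparison_test'[OF summ, of 0])
    fix n
    have "0 \<le> 1 / (real (Suc n) * L n)"
      using L[of n] by simp
    with lower[of n] show "norm (1 / (real (Suc n) * L n)) \<le> gini_mean p q (map a [0..<Suc n])"
      by simp
  qed
  then show False
    using not_summable_inverse_mult_ln by (simp add: L_def)
qed

section \<open>Equivalence of the two properties\<close>

lemma weak_hardy_mean_if_hardy_mean: "hardy_mean I M \<Longrightarrow> weak_hardy_mean I M"
  by (auto simp: hardy_mean_def weak_hardy_mean_def)

lemma gini_mean_map_upt_commute: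
  assumes "a \<in> ell1 {0<..}"
  shows "gini_mean p q (map a [0..<Suc n]) = gini_mean q p (map a [0..<Suc n])"
  using assms by (intro gini_mean_commute) (auto simp: ell1_def)

theorem proposition3:
  fixes p q :: real
  shows "weak_hardy_mean {0<..} (gini_mean p q) \<longleftrightarrow> hardy_mean {0<..} (gini_mean p q)"
proof -
  \<comment> \<open>For \<open>0 < q\<close>, or \<open>q \<le> 0\<close> and
    \<open>1 \<le> p\<close>, both sides fail; in the remaining case both hold.\<close>
  have *: "weak_hardy_mean {0<..} (gini_mean p q) \<longleftrightarrow> hardy_mean {0<..} (gini_mean p q)"
    if "q \<le> p" for p q
    using hardy_gini_mean[of q p] not_weak_hardy_gini_mean_pos[of q p]
      not_weak_hardy_gini_mean_ge_1[of q p] weak_hardy_mean_if_hardy_mean that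
    by (meson not_le)
  show ?thesis
  proof (cases "q \<le> p")
    case False
    \<comment> \<open>The two means agree only on nonempty lists of positive numbers, so the
      rewriting takes place under \<open>a \<in> ell1 {0<..}\<close>.\<close>
    have "weak_hardy_mean {0<..} (gini_mean p q) = weak_hardy_mean {0<..} (gini_mean q p)"
      using gini_mean_map_upt_commute[of _ p q]
      by (simp add: weak_hardy_mean_def cong: ball_cong)
    moreover have "hardy_mean {0<..} (gini_mean p q) = hardy_mean {0<..} (gini_mean q p)"
      using gini_mean_map_upt_commute[of _ p q]
      by (simp add: hardy_mean_def cong: ball_cong)
    ultimately show ?thesis
      using *[of p q] False by simp
  qed (rule *)
qed

end
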